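(* Let $\ell$ be a prime congruent to $3$ modulo $4$ and let $\mathbb{K}$ be a field of characteristic $\ell$. Let $\boldsymbol{\lambda}=(\lambda_k)_{k\in\mathbb{Z}}$ be the doubly infinite paperfolding sequence over $(1,-1)$. Assume that $m\in\mathbb{Z}$ and $n\ge 1$ are integers such that $H_{\boldsymbol{\lambda}}(2m,2n)=0$ in $\mathbb{K}$. Then $H_{\boldsymbol{\lambda}}(m,n)=0$ and $G_{\boldsymbol{\lambda}}(m,n-1)=0$ in $\mathbb{K}$.
   Context: The doubly infinite paperfolding sequence $\boldsymbol{\lambda}=(\lambda_k)_{k\in\mathbb{Z}}$ has values in $\{1,-1\}$ and is determined by $\lambda_{-1}=1$, $\lambda_{2k}=(-1)^k$ and $\lambda_{2k+1}=\lambda_k$ for all $k\in\mathbb{Z}$. For a doubly infinite sequence $\boldsymbol{\gamma}=(\gamma_k)_{k\in\mathbb{Z}}$, $m\in\mathbb{Z}$ and $n\ge 1$, $H_{\boldsymbol{\gamma}}(m,n)=\det(\gamma_{m+i+j})_{0\le i,j\le n-1}$ is the Hankel determinant. Let $\gamma^{**}_k=\gamma_k+2\gamma_{k+1}+\gamma_{k+2}$ for $k\in\mathbb{Z}$. Then $G_{\boldsymbol{\gamma}}(m,n)=H_{\boldsymbol{\gamma^{**}}}(m,n)$ for $n\ge 1$, and $G_{\boldsymbol{\gamma}}(m,0)=1$. *)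

theory Defs
  imports "Jordan_Normal_Form.Determinant" "HOL-Number_Theory.Cong"
    "HOL-Computational_Algebra.Primes"
begin

text \<open>The recursion \<open>\<lambda>\<^sub>2\<^sub>k\<^sub>+\<^sub>1 = \<lambda>\<^sub>k\<close> terminates everywhere except at the
  fixed point \<open>-1\<close>, where the value is prescribed separately.\<close>

function paperfolding :: "int \<Rightarrow> int" where
  "paperfolding k =
     (if k = -1 then 1
      else if even k then (if even (k div 2) then 1 else -1)
      else paperfolding (k div 2))"
  by auto
termination
  by (relation "measure (\<lambda>k. nat \<bar>2 * k + 1\<bar>)") (auto elim!: oddE)

declare paperfolding.simps [simp del]

lemma paperfolding_minus_one: "paperfolding (-1) = 1"
  by (subst paperfolding.simps) simp

lemma paperfolding_even: "paperfolding (2 * k) = (if even k then 1 else -1)"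
proof -
  have "2 * k \<noteq> -1" by presburger
  then show ?thesis by (subst paperfolding.simps) simp
qed

lemma paperfolding_odd: "paperfolding (2 * k + 1) = paperfolding k"
proof (cases "k = -1")
  case True
  then show ?thesis by simp
next
  case False
  then show ?thesis by (subst paperfolding.simps) simp
qed

lemma paperfolding_unique:
  fixes s :: "int \<Rightarrow> int"
  assumes "s (-1) = 1"
    and "\<And>k. s (2 * k) = (if even k then 1 else -1)"
    and "\<And>k. s (2 * k + 1) = s k"
  shows "s = paperfolding"
proof
  fix k show "s k = paperfolding k"
  proof (induction k rule: paperfolding.induct)
    case (1 k)
    show ?case
    proof (cases "even k")
      case True
      then obtain j where "k = 2 * j" by (elim evenE)
      then show ?thesis using assms(2) paperfolding_even by simp
    next
      case False
      then obtain j where j: "k = 2 * j + 1" by (elim oddE)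
      show ?thesis
      proof (cases "k = -1")
        case True
        then show ?thesis using assms(1) paperfolding_minus_one by simp
      next
        case False
        then have "s j = paperfolding j" using 1 j by simp
        then show ?thesis using assms(3) paperfolding_odd j by simp
      qed
    qed
  qed
qed

definition hankel_det :: "(int \<Rightarrow> 'a::comm_ring_1) \<Rightarrow> int \<Rightarrow> nat \<Rightarrow> 'a" where
  "hankel_det \<gamma> m n = det (mat n n (\<lambda>(i, j). \<gamma> (m + int i + int j)))"

definition double_star :: "(int \<Rightarrow> 'a::comm_ring_1) \<Rightarrow> int \<Rightarrow> 'a" where
  "double_star \<gamma> k = \<gamma> k + 2 * \<gamma> (k + 1) + \<gamma> (k + 2)"

definition hankel_det_G :: "(int \<Rightarrow> 'a::comm_ring_1) \<Rightarrow> int \<Rightarrow> nat \<Rightarrow> 'a" where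
  "hankel_det_G \<gamma> m n = (if n = 0 then 1 else hankel_det (double_star \<gamma>) m n)"

end

theory Submission
  imports Defs "HOL-Number_Theory.Residues" "HOL.Complex"
begin

text \<open>
  Over the integers, the determinant in question is a sum of two squares up to sign:
  \<open>H(2m,2n) = (-1)\<^sup>n (H(m,n)\<^sup>2 + G(m,n-1)\<^sup>2)\<close>.
  If \<open>l\<close> is a prime congruent to 3 modulo 4, then \<open>-1\<close> is not a square modulo \<open>l\<close>, so
  \<open>l\<close> divides a sum of two squares only if it divides both terms
  (\<open>prime_3_mod_4_dvd_sum_squares\<close>). Vanishing in a field of characteristic \<open>l\<close>
  is divisibility by \<open>l\<close>, which gives the result.

  The identity (\<open>hankel_det_paperfolding_doubling\<close>) comes from sorting the rows and columns
  of the Hankel matrix by parity. The recursion of the paperfolding sequence turns the entries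
  of even total index into signs and the others into the Hankel matrix \<open>A\<close> of
  \<open>H(m,n)\<close>: the result has the block rows \<open>(E, A)\<close> and \<open>(A, -E)\<close>, where \<open>E\<close> has
  the entries \<open>\<plusminus>(-1)\<^sup>i\<^sup>+\<^sup>j\<close>, with one sign for the whole matrix. Block elimination with
  the complex number \<open>\<i>\<close> factors the determinant as
  \<open>(-1)\<^sup>n det (A + \<i>E) det (A - \<i>E)\<close> (\<open>det_four_block_root_minus_one\<close>). Since \<open>E\<close> has rank one,
  \<open>det (A + c E)\<close> is affine in \<open>c\<close>; its slope is \<open>\<plusminus>G(m,n-1)\<close>
  (\<open>det_sign_perturbation\<close>). Hence the two factors are the conjugate Gaussian integers
  \<open>H(m,n) \<plusminus> \<i> G(m,n-1)\<close>, whose product is their norm.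
\<close>

section \<open>Sums of two squares modulo a prime\<close>

text \<open>
  If \<open>l\<close> divides neither \<open>x\<close> nor \<open>y\<close>, raise \<open>x\<^sup>2 \<equiv> -y\<^sup>2\<close> to the power \<open>(l - 1) / 2\<close>. This
  exponent is odd because \<open>l\<close> is congruent to 3 modulo 4, so Fermat's little theorem yields
  the contradiction \<open>1 \<equiv> -1\<close>.
\<close>

lemma prime_3_mod_4_dvd_sum_squares:
  fixes x y :: int
  assumes "prime l" and l: "[l = 3] (mod 4)" and dvd: "int l dvd x\<^sup>2 + y\<^sup>2"
  shows "int l dvd x"
proof (rule ccontr)
  assume x: "\<not> int l dvd x"
  have prime: "prime (int l)" using \<open>prime l\<close> by simp
  have y: "\<not> int l dvd y"
  proof
    assume "int l dvd y"
    then have "int l dvd y\<^sup>2" by (simp add: power2_eq_square)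
    with dvd have "int l dvd x\<^sup>2" by (simp add: dvd_add_left_iff)
    with x prime show False using prime_dvd_power by blast
  qed
  obtain q where q: "l = 4 * q + 3"
  proof
    have "l mod 4 = 3" using l by (simp add: cong_def)
    then show "l = 4 * (l div 4) + 3" using div_mult_mod_eq[of l 4] by presburger
  qed
  have exp: "l - 1 = 2 * (2 * q + 1)" using q by simp
  have fermat: "[z ^ (l - 1) = 1] (mod int l)" if z: "\<not> int l dvd z" for z :: int
  proof -
    have "\<not> l dvd nat \<bar>z\<bar>" using z by (simp flip: int_dvd_int_iff)
    from fermat_theorem[OF \<open>prime l\<close> this]
    have "[int (nat \<bar>z\<bar> ^ (l - 1)) = int 1] (mod int l)" by (simp only: cong_int_iff)
    moreover have "\<bar>z\<bar> ^ (l - 1) = z ^ (l - 1)" unfolding exp by (rule power_even_abs) simp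
    ultimately show ?thesis by simp
  qed
  have "[x\<^sup>2 = - (y\<^sup>2)] (mod int l)" using dvd by (simp add: cong_iff_dvd_diff)
  then have "[(x\<^sup>2) ^ (2 * q + 1) = (- (y\<^sup>2)) ^ (2 * q + 1)] (mod int l)" by (rule cong_pow)
  moreover have "(- (y\<^sup>2)) ^ (2 * q + 1) = - (y ^ (l - 1))"
    unfolding exp power_mult by (rule power_minus_odd) simp
  ultimately have "[x ^ (l - 1) = - (y ^ (l - 1))] (mod int l)"
    by (simp only: exp power_mult)
  moreover have "[x ^ (l - 1) = 1] (mod int l)" "[y ^ (l - 1) = 1] (mod int l)"
    using x y by (blast intro: fermat)+
  ultimately have "[1 = - 1] (mod int l)"
    by (metis cong_minus_minus_iff cong_sym cong_trans)
  then have "int l dvd 2" by (simp add: cong_iff_dvd_diff)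
  then have "int l \<le> 2" by (rule zdvd_imp_le) simp
  then show False using q by simp
qed

section \<open>Checkerboard perturbations of determinants\<close>

text \<open>
  Adding to each row the original row below it is multiplication from the left by a unitriangular
  matrix.
\<close>

lemma det_add_next_rows:
  fixes x :: "nat \<Rightarrow> nat \<Rightarrow> 'a::comm_ring_1"
  shows "det (mat n n (\<lambda>(i, j). x i j + (if Suc i < n then x (Suc i) j else 0))) =
    det (mat n n (\<lambda>(i, j). x i j))"
proof -
  define L where "L = mat n n (\<lambda>(i, k). if k = i \<or> k = Suc i then 1 else 0 :: 'a)"
  have "diag_mat L = replicate n 1"
    by (rule nth_equalityI) (simp_all add: L_def diag_mat_def)
  then have det_L: "det L = 1"
    by (subst det_upper_triangular[of _ n]) (auto simp: L_def upper_triangular_def)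
  have "mat n n (\<lambda>(i, j). x i j + (if Suc i < n then x (Suc i) j else 0)) =
    L * mat n n (\<lambda>(i, j). x i j)" (is "?X' = _")
  proof (rule eq_matI)
    fix i j assume "i < dim_row (L * mat n n (\<lambda>(i, j). x i j))"
      "j < dim_col (L * mat n n (\<lambda>(i, j). x i j))"
    then have ij: "i < n" "j < n" by (simp_all add: L_def)
    have "(L * mat n n (\<lambda>(i, j). x i j)) $$ (i, j) =
      (\<Sum>k = 0..<n. (if k = i \<or> k = Suc i then 1 else 0) * x k j)"
      using ij by (simp add: L_def scalar_prod_def)
    also have "\<dots> = (\<Sum>k = 0..<n. (if k = i then x k j else 0) + (if k = Suc i then x k j else 0))"
      by (rule sum.cong) auto
    also have "\<dots> = x i j + (if Suc i < n then x (Suc i) j else 0)"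
      using ij by (simp add: sum.distrib)
    finally show "?X' $$ (i, j) = (L * mat n n (\<lambda>(i, j). x i j)) $$ (i, j)"
      using ij by simp
  qed (simp_all add: L_def)
  then show ?thesis
    using det_mult[of L n "mat n n (\<lambda>(i, j). x i j)"] det_L by (simp add: L_def)
qed

lemma det_mat_swap_args:
  fixes x :: "nat \<Rightarrow> nat \<Rightarrow> 'a::comm_ring_1"
  shows "det (mat n n (\<lambda>(i, j). x j i)) = det (mat n n (\<lambda>(i, j). x i j))"
proof -
  have "mat n n (\<lambda>(i, j). x j i) = transpose_mat (mat n n (\<lambda>(i, j). x i j))" by auto
  then show ?thesis by (simp add: det_transpose[of _ n])
qed

lemma det_add_next_cols:
  fixes x :: "nat \<Rightarrow> nat \<Rightarrow> 'a::comm_ring_1"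
  shows "det (mat n n (\<lambda>(i, j). x i j + (if Suc j < n then x i (Suc j) else 0))) =
    det (mat n n (\<lambda>(i, j). x i j))"
  using det_add_next_rows[of n "\<lambda>i j. x j i"]
    det_mat_swap_args[of n "\<lambda>i j. x j i + (if Suc i < n then x j (Suc i) else 0)"]
    det_mat_swap_args[of n x]
  by simp

lemma det_corner_perturbation:
  fixes x :: "nat \<Rightarrow> nat \<Rightarrow> 'a::comm_ring_1"
  shows "det (mat (Suc k) (Suc k) (\<lambda>(i, j). x i j + (if i = k \<and> j = k then c else 0))) =
    det (mat (Suc k) (Suc k) (\<lambda>(i, j). x i j)) + c * det (mat k k (\<lambda>(i, j). x i j))"
proof -
  let ?X = "mat (Suc k) (Suc k) (\<lambda>(i, j). x i j)"
  let ?Y = "mat (Suc k) (Suc k) (\<lambda>(i, j). x i j + (if i = k \<and> j = k then c else 0))"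
  have del: "mat_delete ?Y k j = mat_delete ?X k j" if "j < Suc k" for j
    using that by (intro eq_matI) (auto simp: mat_delete_def)
  have corner: "mat_delete ?X k k = mat k k (\<lambda>(i, j). x i j)"
    by (intro eq_matI) (auto simp: mat_delete_def)
  have "det ?Y = (\<Sum>j<Suc k. ?Y $$ (k, j) * cofactor ?Y k j)"
    by (rule laplace_expansion_row) auto
  also have "\<dots> = (\<Sum>j<Suc k. ?X $$ (k, j) * cofactor ?X k j) + c * cofactor ?X k k"
    by (simp add: cofactor_def del algebra_simps)
  also have "(\<Sum>j<Suc k. ?X $$ (k, j) * cofactor ?X k j) = det ?X"
    by (rule laplace_expansion_row[symmetric]) auto
  also have "cofactor ?X k k = det (mat k k (\<lambda>(i, j). x i j))"
    by (simp add: cofactor_def corner)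
  finally show ?thesis .
qed

text \<open>
  The checkerboard \<open>(-1)\<^sup>i\<^sup>+\<^sup>j\<close> changes sign from each row or column to the next. Adding
  to each row its successor, and then to each column its successor, therefore cancels it
  everywhere except in the last diagonal entry, where the determinant depends on it affinely.
  On \<open>a i j = \<gamma> (m + i + j)\<close> the same operations produce the entries
  \<open>double_star \<gamma> (m + i + j)\<close> of the cofactor of that entry.
\<close>

lemma det_sign_perturbation:
  fixes a :: "nat \<Rightarrow> nat \<Rightarrow> 'a::comm_ring_1"
  shows "det (mat (Suc k) (Suc k) (\<lambda>(i, j). a i j + c * (-1) ^ (i + j))) =
    det (mat (Suc k) (Suc k) (\<lambda>(i, j). a i j)) +
    c * det (mat k k (\<lambda>(i, j). a i j + a (Suc i) j + a i (Suc j) + a (Suc i) (Suc j)))"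
proof -
  define rows :: "(nat \<Rightarrow> nat \<Rightarrow> 'a) \<Rightarrow> nat \<Rightarrow> nat \<Rightarrow> 'a" where
    "rows x i j = x i j + (if Suc i < Suc k then x (Suc i) j else 0)" for x i j
  define both :: "(nat \<Rightarrow> nat \<Rightarrow> 'a) \<Rightarrow> nat \<Rightarrow> nat \<Rightarrow> 'a" where
    "both x i j = rows x i j + (if Suc j < Suc k then rows x i (Suc j) else 0)" for x i j
  have both: "det (mat (Suc k) (Suc k) (\<lambda>(i, j). both x i j)) =
      det (mat (Suc k) (Suc k) (\<lambda>(i, j). x i j))" for x
    unfolding both_def det_add_next_cols unfolding rows_def by (rule det_add_next_rows)
  have "det (mat (Suc k) (Suc k) (\<lambda>(i, j). a i j + c * (-1) ^ (i + j))) =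
      det (mat (Suc k) (Suc k) (\<lambda>(i, j). both (\<lambda>i j. a i j + c * (-1) ^ (i + j)) i j))"
    by (rule both[symmetric])
  also have "mat (Suc k) (Suc k) (\<lambda>(i, j). both (\<lambda>i j. a i j + c * (-1) ^ (i + j)) i j) =
      mat (Suc k) (Suc k) (\<lambda>(i, j). both a i j + (if i = k \<and> j = k then c else 0))"
    by (rule eq_matI) (auto simp: both_def rows_def less_Suc_eq)
  also have "det \<dots> = det (mat (Suc k) (Suc k) (\<lambda>(i, j). both a i j)) +
      c * det (mat k k (\<lambda>(i, j). both a i j))"
    by (rule det_corner_perturbation)
  also have "det (mat (Suc k) (Suc k) (\<lambda>(i, j). both a i j)) =
      det (mat (Suc k) (Suc k) (\<lambda>(i, j). a i j))" by (rule both)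
  also have "mat k k (\<lambda>(i, j). both a i j) =
      mat k k (\<lambda>(i, j). a i j + a (Suc i) j + a i (Suc j) + a (Suc i) (Suc j))"
    by (rule eq_matI) (auto simp: both_def rows_def)
  finally show ?thesis .
qed

section \<open>Determinants of block matrices\<close>

text \<open>
  Adding \<open>-w\<close> times the first block column to the second, and then \<open>w\<close> times the first block
  row to the second, makes the lower right block \<open>-E - w\<^sup>2 E = 0\<close>, so that only the two
  off-diagonal blocks \<open>A - w E\<close> and \<open>A + w E\<close> contribute.
\<close>

lemma det_four_block_root_minus_one:
  fixes A E :: "'a::idom mat"
  assumes A: "A \<in> carrier_mat n n" and E: "E \<in> carrier_mat n n" and w: "w * w = -1"
  shows "det (four_block_mat E A A (- E)) = (-1) ^ n * (det (A + w \<cdot>\<^sub>m E) * det (A - w \<cdot>\<^sub>m E))"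
proof -
  let ?P = "four_block_mat (1\<^sub>m n) (0\<^sub>m n n) (w \<cdot>\<^sub>m 1\<^sub>m n) (1\<^sub>m n)"
  let ?M = "four_block_mat E A A (- E)"
  let ?Q = "four_block_mat (1\<^sub>m n) (- w \<cdot>\<^sub>m 1\<^sub>m n) (0\<^sub>m n n) (1\<^sub>m n)"
  have carr: "?P \<in> carrier_mat (n + n) (n + n)" "?M \<in> carrier_mat (n + n) (n + n)"
    "?Q \<in> carrier_mat (n + n) (n + n)" using A E by auto
  have MQ: "?M * ?Q = four_block_mat E (A - w \<cdot>\<^sub>m E) A (- E - w \<cdot>\<^sub>m A)"
    using A E
    by (subst mult_four_block_mat[where ?n1.0 = n and ?n2.0 = n and ?nr1.0 = n and ?nr2.0 = n
          and ?nc1.0 = n and ?nc2.0 = n])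
       (auto intro!: cong_four_block_mat eq_matI simp: algebra_simps)
  have ww: "w * (w * z) = - z" for z using w by (simp flip: mult.assoc)
  have scalar: "(w \<cdot>\<^sub>m 1\<^sub>m n) * (A - w \<cdot>\<^sub>m E) = w \<cdot>\<^sub>m (A - w \<cdot>\<^sub>m E)"
    using A E by (subst mult_smult_assoc_mat[where nr = n and n = n and nc = n])
      (auto simp: left_mult_one_mat[where nr = n and nc = n])
  have PMQ: "?P * (?M * ?Q) = four_block_mat E (A - w \<cdot>\<^sub>m E) (A + w \<cdot>\<^sub>m E) (0\<^sub>m n n)"
    unfolding MQ using A E
    by (subst mult_four_block_mat[where ?n1.0 = n and ?n2.0 = n and ?nr1.0 = n and ?nr2.0 = n
          and ?nc1.0 = n and ?nc2.0 = n])
       (auto intro!: cong_four_block_mat eq_matI simp: scalar algebra_simps ww)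
  have "det ?P = 1"
    by (subst det_four_block_mat_upper_right_zero[where n = n and m = n]) auto
  moreover have "det ?Q = 1"
    by (subst det_four_block_mat_lower_left_zero[where n = n and m = n]) auto
  ultimately have "det ?M = det (?P * (?M * ?Q))"
    using carr by (simp add: det_mult[where n = "n + n"])
  also have "\<dots> = det (E * 0\<^sub>m n n - (A - w \<cdot>\<^sub>m E) * (A + w \<cdot>\<^sub>m E))"
    unfolding PMQ using A E by (intro det_four_block_mat[where n = n]) auto
  also have "E * 0\<^sub>m n n - (A - w \<cdot>\<^sub>m E) * (A + w \<cdot>\<^sub>m E) =
      (-1) \<cdot>\<^sub>m ((A - w \<cdot>\<^sub>m E) * (A + w \<cdot>\<^sub>m E))"
    using A E by (intro eq_matI) auto
  also have "det \<dots> = (-1) ^ n * (det (A - w \<cdot>\<^sub>m E) * det (A + w \<cdot>\<^sub>m E))"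
    using A E by (simp add: det_mult[OF minus_carrier_mat add_carrier_mat, of _ n])
  finally show ?thesis by (simp add: mult.commute)
qed

text \<open>
  Rows and columns are sorted by the same permutation, so its sign enters squared.
\<close>

lemma det_parity_blocks:
  fixes f :: "nat \<Rightarrow> nat \<Rightarrow> 'a::comm_ring_1"
  shows "det (mat (2 * n) (2 * n) (\<lambda>(i, j). f i j)) =
    det (four_block_mat
      (mat n n (\<lambda>(i, j). f (2 * i) (2 * j))) (mat n n (\<lambda>(i, j). f (2 * i) (2 * j + 1)))
      (mat n n (\<lambda>(i, j). f (2 * i + 1) (2 * j))) (mat n n (\<lambda>(i, j). f (2 * i + 1) (2 * j + 1))))"
    (is "_ = det ?B")
proof -
  \<comment> \<open>Even indices come first; outside the index range \<open>permutes\<close> requires the identity.\<close>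
  define p where "p i = (if i < n then 2 * i else if i < 2 * n then 2 * (i - n) + 1 else i)" for i
  have p: "p permutes {0..<2 * n}"
  proof (rule bij_imp_permutes)
    have "inj_on p {0..<2 * n}"
      by (rule inj_onI) (auto simp: p_def split: if_splits; presburger)
    moreover have "p ` {0..<2 * n} \<subseteq> {0..<2 * n}" by (auto simp: p_def)
    ultimately show "bij_betw p {0..<2 * n} {0..<2 * n}"
      by (simp add: bij_betw_def endo_inj_surj)
  qed (simp add: p_def)
  have p_less: "p i < 2 * n" if "i < 2 * n" for i using that by (auto simp: p_def)
  have perm: "det (mat (2 * n) (2 * n) (\<lambda>(i, j). x (p i) j)) =
      signof p * det (mat (2 * n) (2 * n) (\<lambda>(i, j). x i j))" for x :: "nat \<Rightarrow> nat \<Rightarrow> 'a"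
  proof -
    have "mat (2 * n) (2 * n) (\<lambda>(i, j). x (p i) j) =
      mat (2 * n) (2 * n) (\<lambda>(i, j). mat (2 * n) (2 * n) (\<lambda>(i, j). x i j) $$ (p i, j))"
      by (rule eq_matI) (auto simp: p_less)
    then show ?thesis using det_permute_rows[OF _ p, of "mat (2 * n) (2 * n) (\<lambda>(i, j). x i j)"] by simp
  qed
  have "?B = mat (2 * n) (2 * n) (\<lambda>(i, j). f (p i) (p j))"
    by (rule eq_matI) (auto simp: p_def)
  also have "det \<dots> = signof p * det (mat (2 * n) (2 * n) (\<lambda>(i, j). f i (p j)))"
    by (rule perm)
  also have "det (mat (2 * n) (2 * n) (\<lambda>(i, j). f i (p j))) =
      signof p * det (mat (2 * n) (2 * n) (\<lambda>(i, j). f i j))"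
    using perm[of "\<lambda>i j. f j i"] det_mat_swap_args[of "2 * n" "\<lambda>i j. f j (p i)"]
      det_mat_swap_args[of "2 * n" f] by simp
  finally show ?thesis by (simp add: sign_def)
qed

section \<open>Hankel determinants of the paperfolding sequence\<close>

text \<open>
  The convention for \<open>n = 0\<close> agrees with the value 1 of the empty determinant.
\<close>

lemma hankel_det_G_eq: "hankel_det_G \<gamma> m k = hankel_det (double_star \<gamma>) m k"
  by (simp add: hankel_det_G_def hankel_det_def)

text \<open>
  The complex numbers serve only to factor the determinant; the resulting product of conjugates
  is an integer, and injectivity of the embedding brings the identity back to \<open>\<int>\<close>.
\<close>

theorem hankel_det_paperfolding_doubling:
  "hankel_det paperfolding (2 * m) (2 * Suc k) =
    (-1) ^ Suc k * ((hankel_det paperfolding m (Suc k))\<^sup>2 + (hankel_det_G paperfolding m k)\<^sup>2)"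
proof -
  define e :: int where "e = (if even m then 1 else -1)"
  have e: "e * e = 1" by (simp add: e_def)
  let ?n = "Suc k"
  let ?a = "\<lambda>i j. complex_of_int (paperfolding (m + int i + int j))"
  let ?A = "mat ?n ?n (\<lambda>(i, j). ?a i j)"
  let ?E = "mat ?n ?n (\<lambda>(i, j). complex_of_int (e * (-1) ^ (i + j)))"
  have even_even: "paperfolding (2 * m + int (2 * i) + int (2 * j)) = e * (-1) ^ (i + j)" for i j
    using paperfolding_even[of "m + int i + int j"] by (auto simp: e_def algebra_simps)
  have odd_odd: "paperfolding (2 * m + int (Suc (2 * i)) + int (Suc (2 * j))) = - (e * (-1) ^ (i + j))" for i j
    using even_even[of "Suc i" j] by (simp add: algebra_simps)
  have even_odd: "paperfolding (2 * m + int (2 * i) + int (Suc (2 * j))) = paperfolding (m + int i + int j)"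
    and odd_even: "paperfolding (2 * m + int (Suc (2 * i)) + int (2 * j)) = paperfolding (m + int i + int j)" for i j
    using paperfolding_odd[of "m + int i + int j"] by (simp_all add: algebra_simps)
  have pert: "det (mat ?n ?n (\<lambda>(i, j). ?a i j + c * (-1) ^ (i + j))) =
      of_int (hankel_det paperfolding m ?n) + c * of_int (hankel_det_G paperfolding m k)" for c
  proof -
    have "mat k k (\<lambda>(i, j). ?a i j + ?a (Suc i) j + ?a i (Suc j) + ?a (Suc i) (Suc j)) =
       map_mat of_int (mat k k (\<lambda>(i, j). double_star paperfolding (m + int i + int j)))"
      by (rule eq_matI) (auto simp: double_star_def algebra_simps)
    then have G: "det (mat k k (\<lambda>(i, j). ?a i j + ?a (Suc i) j + ?a i (Suc j) + ?a (Suc i) (Suc j))) =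
       of_int (hankel_det_G paperfolding m k)"
      by (simp add: of_int_hom.hom_det hankel_det_G_eq hankel_det_def)
    have "?A = map_mat of_int (mat ?n ?n (\<lambda>(i, j). paperfolding (m + int i + int j)))"
      by (rule eq_matI) auto
    then have H: "det ?A = of_int (hankel_det paperfolding m ?n)"
      by (simp only: of_int_hom.hom_det hankel_det_def)
    show ?thesis unfolding det_sign_perturbation G H ..
  qed
  have "complex_of_int (hankel_det paperfolding (2 * m) (2 * ?n)) =
      det (map_mat complex_of_int (mat (2 * ?n) (2 * ?n) (\<lambda>(i, j). paperfolding (2 * m + int i + int j))))"
    by (simp only: of_int_hom.hom_det hankel_det_def)
  also have "map_mat complex_of_int (mat (2 * ?n) (2 * ?n) (\<lambda>(i, j). paperfolding (2 * m + int i + int j))) =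
      mat (2 * ?n) (2 * ?n) (\<lambda>(i, j). complex_of_int (paperfolding (2 * m + int i + int j)))"
    by (rule eq_matI) auto
  also have "det \<dots> = det (four_block_mat ?E ?A ?A (- ?E))"
    unfolding det_parity_blocks
    by (rule arg_cong[where f = det], rule cong_four_block_mat; rule eq_matI)
       (simp_all add: even_even even_odd odd_even odd_odd del: of_nat_Suc of_nat_mult of_nat_add)
  also have "\<dots> = (-1) ^ ?n * (det (?A + \<i> \<cdot>\<^sub>m ?E) * det (?A - \<i> \<cdot>\<^sub>m ?E))"
    by (rule det_four_block_root_minus_one) auto
  also have "?A + \<i> \<cdot>\<^sub>m ?E = mat ?n ?n (\<lambda>(i, j). ?a i j + (\<i> * of_int e) * (-1) ^ (i + j))"
    by (rule eq_matI) auto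
  also have "?A - \<i> \<cdot>\<^sub>m ?E = mat ?n ?n (\<lambda>(i, j). ?a i j + (- \<i> * of_int e) * (-1) ^ (i + j))"
    by (rule eq_matI) auto
  also have "det (mat ?n ?n (\<lambda>(i, j). ?a i j + (\<i> * of_int e) * (-1) ^ (i + j))) *
      det (mat ?n ?n (\<lambda>(i, j). ?a i j + (- \<i> * of_int e) * (-1) ^ (i + j))) =
      of_int ((hankel_det paperfolding m ?n)\<^sup>2 + (e * e) * (hankel_det_G paperfolding m k)\<^sup>2)"
    unfolding pert by (simp add: algebra_simps power2_eq_square)
  finally show ?thesis
    unfolding e by (simp flip: of_int_eq_iff[where 'a = complex])
qed

theorem corollary3p3:
  fixes l :: nat and m :: int and n :: nat
  assumes "prime l" and "[l = 3] (mod 4)"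
    and "CHAR('k::field) = l"
    and "n \<ge> 1"
    and "(of_int (hankel_det paperfolding (2 * m) (2 * n)) :: 'k) = 0"
  shows "(of_int (hankel_det paperfolding m n) :: 'k) = 0
    \<and> (of_int (hankel_det_G paperfolding m (n - 1)) :: 'k) = 0"
proof -
  let ?H = "hankel_det paperfolding m n" and ?G = "hankel_det_G paperfolding m (n - 1)"
  have zero_iff: "(of_int z :: 'k) = 0 \<longleftrightarrow> int l dvd z" for z
    using assms(3) by (simp add: of_int_eq_0_iff_char_dvd)
  have "hankel_det paperfolding (2 * m) (2 * n) = (-1) ^ n * (?H\<^sup>2 + ?G\<^sup>2)"
    using hankel_det_paperfolding_doubling[of m "n - 1"] assms(4) by simp
  then have "int l dvd (-1) ^ n * (?H\<^sup>2 + ?G\<^sup>2)" using assms(5) by (simp only: zero_iff)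
  then have sum: "int l dvd ?H\<^sup>2 + ?G\<^sup>2"
    by (rule dvd_mult_unit_iff'[THEN iffD1, rotated]) (simp add: is_unit_power_iff)
  then have "int l dvd ?H" by (rule prime_3_mod_4_dvd_sum_squares[OF assms(1,2)])
  moreover have "int l dvd ?G"
    using sum by (intro prime_3_mod_4_dvd_sum_squares[OF assms(1,2), of ?G ?H]) (simp only: add.commute)
  ultimately show ?thesis by (simp add: zero_iff)
qed

end
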